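(* Let $q_1,q_2$ and $k\geq3$ be given natural integers. Let $p$ run over the primes not dividing $q_1q_2$, and $h$ over the elements of order $k$ in $(\mathbb Z/p\mathbb Z)^*$. Then $$|s(q_1,q_2h,p)|\ll (\log p)^2p^{1-\frac{1}{\phi(k)}},$$ where the implied constant may depend on $q_1,q_2,k$ but not on $p$ or $h$.
   Context: For integers $b,c$ and a prime $p$ with $p\nmid bc$, the Dedekind–Rademacher sum is $s(b,c,p)=\frac{1}{4p}\sum_{n=1}^{p-1}\cot\left(\frac{\pi nb}{p}\right)\cot\left(\frac{\pi nc}{p}\right)=\sum_{a=1}^{p-1}((ab/p))((ac/p))$, where $((x))=x-\lfloor x\rfloor-1/2$ for $x\notin\mathbb Z$ and $((x))=0$ for $x\in\mathbb Z$. *)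

theory Defs
  imports Complex_Main "HOL-Number_Theory.Number_Theory"
begin

text \<open>
  The Dedekind--Rademacher sum \<open>s(b, c, p)\<close> in its cotangent form, for integers \<open>b\<close>, \<open>c\<close>
  and a prime \<open>p\<close> not dividing \<open>b * c\<close>. Since the cotangent has period \<open>pi\<close>, its value
  depends only on the residue classes of \<open>b\<close> and \<open>c\<close> modulo \<open>p\<close>.
\<close>

definition dedekind_rademacher_sum :: "int \<Rightarrow> int \<Rightarrow> nat \<Rightarrow> real" where
  "dedekind_rademacher_sum b c p =
     1 / (4 * real p) *
       (\<Sum>n = 1..p - 1. cot (pi * real n * real_of_int b / real p) *
                         cot (pi * real n * real_of_int c / real p))"

end

theory Submission
  imports Defs "HOL-Computational_Algebra.Polynomial" "HOL-Analysis.Harmonic_Numbers"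
    "HOL-Library.Centered_Division"
begin

text \<open>
  For \<open>0 < n < p\<close> let \<open>x\<close> and \<open>y\<close> be the absolutely least residues of \<open>n * q1\<close> and
  \<open>n * q2 * h\<close> modulo \<open>p\<close>, so that \<open>q1 * y\<close> is congruent to \<open>h * (q2 * x)\<close>. Since the cyclotomic
  polynomial \<open>\<Phi>\<close> of index \<open>k\<close> vanishes at \<open>h\<close> modulo \<open>p\<close>, its homogenization at
  \<open>(q1 * y, q2 * x)\<close> is a multiple of \<open>p\<close>, and it is nonzero because \<open>\<Phi>\<close> has no real root.
  Hence \<open>max \<bar>x\<bar> \<bar>y\<bar>\<close> is at least a constant times \<open>M = p powr (1 / \<phi>(k))\<close>. As
  \<open>\<bar>cot (pi * m / p)\<bar> \<le> p / \<bar>r\<bar>\<close> for the least residue \<open>r\<close> of \<open>m\<close>, the Dedekind sum is at most of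
  order \<open>p * (\<Sum>n. 1 / (\<bar>x\<bar> * \<bar>y\<bar>))\<close>, thus of order \<open>p / M * (\<Sum>n. 1 / \<bar>x\<bar> + 1 / \<bar>y\<bar>)\<close>; both sums
  are harmonic sums, as \<open>x\<close> and \<open>y\<close> run through all nonzero residues.
\<close>

section \<open>Cyclotomic polynomials over the complex numbers\<close>

definition primitive_roots_unity :: "nat \<Rightarrow> complex set" where
  "primitive_roots_unity n = {z. z ^ n = 1 \<and> (\<forall>m. 0 < m \<longrightarrow> m < n \<longrightarrow> z ^ m \<noteq> 1)}"

text \<open>For \<open>n = 0\<close> the index set is all of the complex plane and the product over
  an infinite set defaults to 1. This is still monic, but the degree formula and integrality are
  stated for \<open>n > 0\<close>.\<close>

definition cyclotomic :: "nat \<Rightarrow> complex poly" where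
  "cyclotomic n = (\<Prod>z\<in>primitive_roots_unity n. [:-z, 1:])"

lemma finite_primitive_roots_unity: "n > 0 \<Longrightarrow> finite (primitive_roots_unity n)"
  by (rule finite_subset[of _ "{z. z ^ n = 1}"])
     (auto simp: primitive_roots_unity_def finite_roots_unity)

lemma disjoint_primitive_roots_unity:
  assumes "m > 0" "n > 0" "m \<noteq> n"
  shows "primitive_roots_unity m \<inter> primitive_roots_unity n = {}"
  using assms unfolding primitive_roots_unity_def by (auto; metis linorder_neqE_nat)

text \<open>An \<open>n\<close>-th root of unity has an exact order \<open>d\<close>; division of
  \<open>n\<close> by \<open>d\<close> with remainder and minimality of \<open>d\<close> give
  \<open>d dvd n\<close>.\<close>

lemma roots_unity_eq_UN_primitive:
  assumes "n > 0"
  shows "{z::complex. z ^ n = 1} = (\<Union>d\<in>{d. d dvd n}. primitive_roots_unity d)"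
proof (intro subset_antisym subsetI)
  fix z :: complex assume "z \<in> {z. z ^ n = 1}"
  hence z: "z ^ n = 1" by simp
  define d where "d = (LEAST m. 0 < m \<and> z ^ m = 1)"
  have d: "0 < d \<and> z ^ d = 1"
    unfolding d_def by (rule LeastI[of _ n]) (use assms z in auto)
  have min: "z ^ m \<noteq> 1" if "0 < m" "m < d" for m
    using not_less_Least[of m "\<lambda>m. 0 < m \<and> z ^ m = 1"] that by (auto simp: d_def)
  have "z ^ n = (z ^ d) ^ (n div d) * z ^ (n mod d)"
    by (metis div_mult_mod_eq mult.commute power_add power_mult)
  hence "z ^ (n mod d) = 1" using z d by simp
  hence "n mod d = 0" using min[of "n mod d"] d by (metis gr0I mod_less_divisor)
  hence "d dvd n" by auto
  moreover have "z \<in> primitive_roots_unity d"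
    using d min by (auto simp: primitive_roots_unity_def)
  ultimately show "z \<in> (\<Union>d\<in>{d. d dvd n}. primitive_roots_unity d)" by blast
next
  fix z assume "z \<in> (\<Union>d\<in>{d. d dvd n}. primitive_roots_unity d)"
  then obtain d where "d dvd n" "z ^ d = 1" by (auto simp: primitive_roots_unity_def)
  thus "z \<in> {z. z ^ n = 1}" by (auto elim!: dvdE simp: power_mult)
qed

text \<open>Both sides, summed over the divisors of \<open>n\<close>, give \<open>n\<close>. Strong
  induction cancels the proper divisors.\<close>

lemma card_primitive_roots_unity:
  "n > 0 \<Longrightarrow> card (primitive_roots_unity n) = totient n"
proof (induction n rule: less_induct)
  case (less n)
  define D where "D = {d. d dvd n} - {n}"
  have fin: "finite {d. d dvd n}" using less.prems by simp
  have split: "{d. d dvd n} = insert n D" "n \<notin> D" "finite D" using fin by (auto simp: D_def)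
  have pos: "d > 0" if "d dvd n" for d using that less.prems by (auto intro: dvd_pos_nat)
  have "n = card {z::complex. z ^ n = 1}" using less.prems by (simp add: card_roots_unity_eq)
  also have "\<dots> = (\<Sum>d | d dvd n. card (primitive_roots_unity d))"
    unfolding roots_unity_eq_UN_primitive[OF less.prems]
    using fin pos
    by (intro card_UN_disjoint) (auto simp: finite_primitive_roots_unity disjoint_primitive_roots_unity)
  also have "\<dots> = card (primitive_roots_unity n) + (\<Sum>d\<in>D. card (primitive_roots_unity d))"
    using split by simp
  also have "(\<Sum>d\<in>D. card (primitive_roots_unity d)) = (\<Sum>d\<in>D. totient d)"
    using less.prems pos
    by (intro sum.cong refl less.IH) (auto simp: D_def dest: dvd_imp_le)
  finally have "n = card (primitive_roots_unity n) + (\<Sum>d\<in>D. totient d)" .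
  moreover have "n = totient n + (\<Sum>d\<in>D. totient d)"
    using totient_divisor_sum[of n] split by simp
  ultimately show ?case by linarith
qed

lemma degree_cyclotomic: "n > 0 \<Longrightarrow> degree (cyclotomic n) = totient n"
  unfolding cyclotomic_def
  by (subst degree_prod_sum_eq) (auto simp: card_primitive_roots_unity)

lemma lead_coeff_cyclotomic: "lead_coeff (cyclotomic n) = 1"
  unfolding cyclotomic_def by (simp add: lead_coeff_prod)

lemma poly_cyclotomic_eq_0_iff:
  "n > 0 \<Longrightarrow> poly (cyclotomic n) z = 0 \<longleftrightarrow> z \<in> primitive_roots_unity n"
  by (auto simp: cyclotomic_def poly_prod finite_primitive_roots_unity)

text \<open>Both sides are monic of degree \<open>n\<close> and vanish at the \<open>n\<close>
  distinct \<open>n\<close>-th roots of unity, so they coincide.\<close>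

lemma prod_cyclotomic:
  assumes "n > 0"
  shows "(\<Prod>d | d dvd n. cyclotomic d) = monom 1 n - 1"
proof -
  let ?R = "{z::complex. z ^ n = 1}"
  have fin: "finite ?R" using assms by (simp add: finite_roots_unity)
  have pos: "d > 0" if "d dvd n" for d using that assms by (auto intro: dvd_pos_nat)
  have "(\<Prod>d | d dvd n. cyclotomic d) = (\<Prod>z\<in>?R. [:-z, 1:])"
    unfolding cyclotomic_def roots_unity_eq_UN_primitive[OF assms]
    using assms pos
    by (intro prod.UNION_disjoint[symmetric])
       (auto simp: finite_primitive_roots_unity disjoint_primitive_roots_unity)
  also have "\<dots> = monom 1 n - 1"
  proof (rule poly_eqI_degree_lead_coeff[of _ n _ ?R])
    have deg: "degree (\<Prod>z\<in>?R. [:-z, 1:]) = n"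
      using assms by (subst degree_prod_sum_eq) (auto simp: card_roots_unity_eq)
    show "degree (\<Prod>z\<in>?R. [:-z, 1:]) \<le> n" using deg by simp
    have "lead_coeff (\<Prod>z\<in>?R. [:-z, 1:]) = 1" by (simp add: lead_coeff_prod)
    thus "coeff (\<Prod>z\<in>?R. [:-z, 1:]) n = coeff (monom 1 n - 1) n" using deg assms by simp
    show "degree (monom (1::complex) n - 1) \<le> n"
      by (intro degree_diff_le) (auto simp: degree_monom_le)
    show "n \<le> card ?R" using assms by (simp add: card_roots_unity_eq)
    show "poly (\<Prod>z\<in>?R. [:-z, 1:]) z = poly (monom 1 n - 1) z" if "z \<in> ?R" for z
      using that fin by (auto simp: poly_prod poly_monom prod_zero_iff)
  qed
  finally show ?thesis .
qed

section \<open>Integer coefficients and absence of real roots\<close>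

text \<open>Downward induction on \<open>i\<close>: the coefficient of \<open>p * q\<close> at \<open>i + degree q\<close> is
  \<open>coeff p i\<close> plus terms that only involve higher coefficients of \<open>p\<close>.\<close>
lemma coeff_Ints_cancel_monic:
  fixes p q :: "'a::comm_ring_1 poly"
  assumes "lead_coeff q = 1" "\<And>i. coeff q i \<in> \<int>" "\<And>i. coeff (p * q) i \<in> \<int>"
  shows "coeff p i \<in> \<int>"
proof (induction "Suc (degree p) - i" arbitrary: i rule: less_induct)
  case less
  show ?case
  proof (cases "i > degree p")
    case True
    thus ?thesis by (simp add: coeff_eq_0)
  next
    case False
    define m where "m = degree q"
    have "coeff (p * q) (i + m) = (\<Sum>j\<le>i+m. coeff q j * coeff p (i + m - j))"
      by (subst mult.commute) (simp add: coeff_mult)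
    also have "\<dots> = (\<Sum>j\<le>m. coeff q j * coeff p (i + m - j))"
      by (rule sum.mono_neutral_right) (auto simp: m_def coeff_eq_0)
    also have "\<dots> = (\<Sum>j<m. coeff q j * coeff p (i + m - j)) + coeff p i"
      using assms(1) by (simp add: m_def lessThan_Suc_atMost[symmetric])
    finally have "coeff p i = coeff (p * q) (i + m) - (\<Sum>j<m. coeff q j * coeff p (i + m - j))"
      by simp
    also have "\<dots> \<in> \<int>"
      using False assms by (intro Ints_diff Ints_sum Ints_mult less) auto
    finally show ?thesis .
  qed
qed

lemma coeff_prod_Ints:
  fixes f :: "'b \<Rightarrow> 'a::comm_ring_1 poly"
  assumes "\<And>x i. x \<in> A \<Longrightarrow> coeff (f x) i \<in> \<int>"
  shows "coeff (prod f A) i \<in> \<int>"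
  using assms
proof (induction A arbitrary: i rule: infinite_finite_induct)
  case (insert x A)
  thus ?case by (simp, intro coeff_mult_semiring_closed) auto
qed (auto simp: coeff_1)

text \<open>The factors for proper divisors are monic and, by induction, integral, so their product
  can be cancelled from \<open>monom 1 n - 1\<close> without leaving the integers.\<close>

lemma coeff_cyclotomic_Ints: "n > 0 \<Longrightarrow> coeff (cyclotomic n) i \<in> \<int>"
proof (induction n arbitrary: i rule: less_induct)
  case (less n)
  define D where "D = {d. d dvd n} - {n}"
  have split: "{d. d dvd n} = insert n D" "n \<notin> D" "finite D"
    using less.prems by (auto simp: D_def)
  have "cyclotomic n * (\<Prod>d\<in>D. cyclotomic d) = monom 1 n - 1"
    using prod_cyclotomic[OF less.prems] split by simp
  hence "coeff (cyclotomic n * (\<Prod>d\<in>D. cyclotomic d)) i \<in> \<int>" for i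
    by (auto simp: coeff_1)
  moreover have "coeff (\<Prod>d\<in>D. cyclotomic d) i \<in> \<int>" for i
  proof (rule coeff_prod_Ints)
    fix d i assume "d \<in> D"
    hence "d dvd n" "d \<noteq> n" by (auto simp: D_def)
    thus "coeff (cyclotomic d) i \<in> \<int>"
      using less.prems by (intro less.IH) (auto dest: dvd_imp_le intro: dvd_pos_nat)
  qed
  moreover have "lead_coeff (\<Prod>d\<in>D. cyclotomic d) = 1"
    by (simp add: lead_coeff_prod lead_coeff_cyclotomic)
  ultimately show ?case
    by (intro coeff_Ints_cancel_monic[of "\<Prod>d\<in>D. cyclotomic d" "cyclotomic n"])
qed

lemma cyclotomic_int_poly:
  assumes "n > 0"
  obtains P :: "int poly" where "cyclotomic n = map_poly of_int P"
  using assms coeff_cyclotomic_Ints by (metis intpolyE)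

lemma poly_map_poly_of_int:
  "poly (map_poly of_int P) (of_int x :: 'a::comm_ring_1) = of_int (poly P x)"
  by (induction P) (auto simp: map_poly_pCons)

text \<open>The only real roots of unity are 1 and -1. Their squares are 1, so they cannot have
  order 3 or more.\<close>

lemma cyclotomic_real_root_free:
  assumes "n \<ge> 3"
  shows "poly (cyclotomic n) (of_real x) \<noteq> 0"
proof
  assume "poly (cyclotomic n) (of_real x) = 0"
  hence z: "of_real x \<in> primitive_roots_unity n"
    using assms by (simp add: poly_cyclotomic_eq_0_iff)
  hence "complex_of_real (x ^ n) = 1" by (simp add: primitive_roots_unity_def)
  hence "x ^ n = 1" by (simp only: of_real_eq_1_iff)
  hence "\<bar>x\<bar> ^ n = 1" by (simp flip: power_abs)
  hence "\<bar>x\<bar> = 1" using assms power_eq_imp_eq_base[of "\<bar>x\<bar>" n 1] by simp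
  hence "x ^ 2 = 1" by (simp add: abs_square_eq_1)
  hence "(of_real x :: complex) ^ 2 = 1" by (metis of_real_1 of_real_power)
  thus False using z assms by (auto simp: primitive_roots_unity_def)
qed

section \<open>Cyclotomic values modulo a prime and the resulting lower bound\<close>

text \<open>Euler's theorem, applied to the natural representative \<open>a\<close> of
  \<open>h\<close>, supplies an admissible exponent, so the \<open>LEAST\<close> defining
  \<open>ord\<close> is attained.\<close>

lemma ord_int_prime:
  fixes h :: int
  assumes "prime p" "coprime h (int p)"
  shows "[h ^ ord (int p) h = 1] (mod int p)" and "ord (int p) h > 0"
    and "\<And>d. d > 0 \<Longrightarrow> [h ^ d = 1] (mod int p) \<Longrightarrow> ord (int p) h \<le> d"
proof -
  define a where "a = nat (h mod int p)"
  have p: "p > 1" using assms(1) by (rule prime_gt_1_nat)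
  have a: "int a = h mod int p" using p by (simp add: a_def)
  have ord: "ord (int p) h = (LEAST d. d > 0 \<and> [h ^ d = 1] (mod int p))"
    using assms by (simp add: ord_def coprime_commute)
  have "coprime (int a) (int p)" using assms a by simp
  hence "[a ^ totient p = 1] (mod p)" by (intro euler_theorem) simp
  hence "[int a ^ totient p = 1] (mod int p)"
    by (metis cong_int_iff of_nat_1 of_nat_power)
  hence "[h ^ totient p = 1] (mod int p)"
    unfolding a cong_def by (simp add: power_mod)
  moreover have "totient p > 0" using p by simp
  ultimately have "ord (int p) h > 0 \<and> [h ^ ord (int p) h = 1] (mod int p)"
    unfolding ord
    using LeastI[of "\<lambda>d. d > 0 \<and> [h ^ d = 1] (mod int p)" "totient p"] by auto
  thus "[h ^ ord (int p) h = 1] (mod int p)" "ord (int p) h > 0" by auto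
  show "ord (int p) h \<le> d" if "d > 0" "[h ^ d = 1] (mod int p)" for d
    unfolding ord by (rule Least_le) (use that in auto)
qed

text \<open>The prime \<open>p\<close> divides \<open>h ^ k - 1\<close>, hence the cyclotomic value
  at \<open>h\<close> of some index \<open>d\<close> dividing \<open>k\<close>. That value divides
  \<open>h ^ d - 1\<close>, so minimality of the order forces \<open>d = k\<close>.\<close>

lemma prime_dvd_cyclotomic:
  fixes h :: int
  assumes "prime p" "coprime h (int p)" "cyclotomic (ord (int p) h) = map_poly of_int P"
  shows "int p dvd poly P h"
proof -
  define k where "k = ord (int p) h"
  note o = ord_int_prime[OF assms(1,2), folded k_def]
  have pos: "d > 0" if "d dvd k" for d using that o(2) by (auto intro: dvd_pos_nat)
  have "\<exists>R :: int poly. cyclotomic d = map_poly of_int R" if "d dvd k" for d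
    using cyclotomic_int_poly[OF pos[OF that]] by metis
  then obtain R :: "nat \<Rightarrow> int poly" where
    R: "\<And>d. d dvd k \<Longrightarrow> cyclotomic d = map_poly of_int (R d)" by metis
  \<comment> \<open>Stated for every divisor \<open>n\<close> of \<open>k\<close>, since it is
    applied both at \<open>k\<close> and at the index \<open>d\<close> found below.\<close>
  have prod_R: "(\<Prod>d | d dvd n. poly (R d) h) = h ^ n - 1" if "n dvd k" for n
  proof -
    have "of_int (\<Prod>d | d dvd n. poly (R d) h) =
            (\<Prod>d | d dvd n. poly (cyclotomic d) (of_int h))"
      unfolding of_int_prod
      by (intro prod.cong refl)
         (use R that dvd_trans in \<open>auto simp: poly_map_poly_of_int\<close>)
    also have "\<dots> = of_int (h ^ n - 1)"
      using prod_cyclotomic[OF pos[OF that]]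
      by (simp add: poly_prod[symmetric] poly_monom)
    finally show ?thesis by (simp only: of_int_eq_iff)
  qed
  have "int p dvd (\<Prod>d | d dvd k. poly (R d) h)"
    using o(1) by (simp add: prod_R cong_iff_dvd_diff)
  moreover have "finite {d. d dvd k}" using o(2) by simp
  ultimately obtain d where d: "d dvd k" "int p dvd poly (R d) h"
    using assms(1) by (auto simp: prime_dvd_prod_iff)
  have "poly (R d) h dvd (\<Prod>e | e dvd d. poly (R e) h)"
    using pos[OF d(1)] by (intro dvd_prodI) auto
  hence "int p dvd h ^ d - 1" using prod_R[OF d(1)] d(2) dvd_trans by metis
  hence "k \<le> d" using pos[OF d(1)] by (intro o(3)) (auto simp: cong_iff_dvd_diff)
  hence "d = k" using d(1) o(2) by (simp add: dvd_imp_le le_antisym)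
  moreover have "map_poly of_int (R k) = (map_poly of_int P :: complex poly)"
    using R[of k] assms(3) by (simp add: k_def)
  hence "R k = P" by (simp add: poly_eq_iff coeff_map_poly)
  ultimately show ?thesis using d by simp
qed

text \<open>The homogenized cyclotomic polynomial at \<open>(X, Y)\<close> is a nonzero multiple of
  \<open>p\<close>, so its absolute value is at least \<open>p\<close>, while each monomial is at
  most \<open>N ^ totient k\<close>. The constant \<open>A\<close>, the sum of the absolute
  coefficients, depends on \<open>k\<close> only.\<close>

lemma prime_le_norm_form:
  assumes "k \<ge> 3"
  obtains A :: int where "A \<ge> 1"
    and "\<And>p h X Y N. \<lbrakk>prime p; coprime h (int p); ord (int p) h = k; Y \<noteq> 0;
            [X = h * Y] (mod int p); \<bar>X\<bar> \<le> N; \<bar>Y\<bar> \<le> N\<rbrakk> \<Longrightarrow> int p \<le> A * N ^ totient k"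
proof -
  obtain P :: "int poly" where P: "cyclotomic k = map_poly of_int P"
    using cyclotomic_int_poly[of k] assms by auto
  define f where "f = totient k"
  have "degree (map_poly of_int P :: complex poly) = degree P"
    by (intro degree_map_poly) auto
  hence deg: "degree P = f"
    using degree_cyclotomic[of k] assms by (simp add: P f_def)
  define A where "A = (\<Sum>i\<le>f. \<bar>coeff P i\<bar>)"
  have bound: "int p \<le> A * N ^ f"
    if p: "prime p" and h: "coprime h (int p)" "ord (int p) h = k" and Y: "Y \<noteq> 0"
      and X: "[X = h * Y] (mod int p)" and N: "\<bar>X\<bar> \<le> N" "\<bar>Y\<bar> \<le> N" for p h X Y N
  proof -
    define F where "F = (\<Sum>i\<le>f. coeff P i * (X ^ i * Y ^ (f - i)))"
    \<comment> \<open>Since \<open>Y\<close> is nonzero, \<open>F\<close> is a nonzero factor times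
      the value at the real point \<open>X / Y\<close>, which is not a root.\<close>
    have "of_int F = of_int Y ^ f * poly (cyclotomic k) (of_real (of_int X / of_int Y))"
      using Y unfolding F_def of_int_sum P poly_altdef sum_distrib_left
      by (intro sum.cong)
         (auto simp: coeff_map_poly degree_map_poly deg field_simps simp flip: power_add)
    hence "F \<noteq> 0"
      using Y cyclotomic_real_root_free[OF assms]
      by (metis mult_eq_0_iff of_int_0_eq_iff of_int_0 power_not_zero)
    moreover have "[F = (\<Sum>i\<le>f. coeff P i * ((h * Y) ^ i * Y ^ (f - i)))] (mod int p)"
      unfolding F_def by (intro cong_sum cong_mult cong_pow X) auto
    have "(\<Sum>i\<le>f. coeff P i * ((h * Y) ^ i * Y ^ (f - i))) = Y ^ f * poly P h"
      unfolding poly_altdef deg sum_distrib_left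
      by (intro sum.cong) (auto simp: power_mult_distrib simp flip: power_add)
    with \<open>[F = _] (mod int p)\<close> have "int p dvd F"
      using prime_dvd_cyclotomic[OF p h(1), of P] P h(2) by (simp add: cong_dvd_iff)
    ultimately have "int p \<le> \<bar>F\<bar>" using dvd_imp_le_int[of F "int p"] by simp
    also have "\<bar>F\<bar> \<le> (\<Sum>i\<le>f. \<bar>coeff P i\<bar> * N ^ f)"
      unfolding F_def
    proof (intro order_trans[OF sum_abs] sum_mono)
      fix i assume "i \<in> {..f}"
      have "\<bar>X\<bar> ^ i * \<bar>Y\<bar> ^ (f - i) \<le> N ^ i * N ^ (f - i)"
        using N by (intro mult_mono power_mono) auto
      also have "\<dots> = N ^ f" using \<open>i \<in> {..f}\<close> by (simp flip: power_add)
      finally show "\<bar>coeff P i * (X ^ i * Y ^ (f - i))\<bar> \<le> \<bar>coeff P i\<bar> * N ^ f"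
        by (simp add: abs_mult power_abs mult_left_mono)
    qed
    also have "\<dots> = A * N ^ f" by (simp add: A_def sum_distrib_right)
    finally show ?thesis .
  qed
  \<comment> \<open>The bound \<open>A \<ge> 1\<close> later allows replacing \<open>A\<close> by
    \<open>A ^ f\<close> before an \<open>f\<close>-th root is taken.\<close>
  have "coeff P f \<noteq> 0"
    using lead_coeff_cyclotomic[of k] assms deg by (auto simp: P)
  hence "1 \<le> \<bar>coeff P f\<bar>" by simp
  also have "\<dots> \<le> A" unfolding A_def by (intro member_le_sum) auto
  finally show thesis using bound unfolding f_def by (intro that) auto
qed

section \<open>Cotangent estimates and harmonic sums over residues\<close>

text \<open>The function \<open>sin t - t * cos t\<close> vanishes at 0 and has derivative
  \<open>t * sin t\<close>, so \<open>y * cos y \<le> sin y\<close>.\<close>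

lemma abs_cot_le:
  fixes y :: real
  assumes "0 < y" "y \<le> pi / 2"
  shows "\<bar>cot y\<bar> \<le> 1 / y"
proof -
  have "sin 0 - 0 * cos 0 \<le> sin y - y * cos y"
  proof (rule DERIV_nonneg_imp_nondecreasing[where f = "\<lambda>t. sin t - t * cos t"])
    fix t assume t: "0 \<le> t" "t \<le> y"
    show "\<exists>d. ((\<lambda>t. sin t - t * cos t) has_real_derivative d) (at t) \<and> d \<ge> 0"
      using t assms by (intro exI[of _ "t * sin t"] conjI)
        (auto intro!: derivative_eq_intros mult_nonneg_nonneg sin_ge_zero)
  qed (use assms in auto)
  moreover have "sin y > 0" "cos y \<ge> 0"
    using assms by (auto intro!: sin_gt_zero cos_ge_zero)
  ultimately show ?thesis
    using assms by (simp add: cot_def field_simps)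
qed

text \<open>Periodicity and oddness of the cotangent replace \<open>m\<close> by
  \<open>\<bar>r\<bar>\<close>, where \<open>\<bar>r\<bar> \<le> p / 2\<close> puts the argument
  into the range of \<open>abs_cot_le\<close>. The gain of a factor \<open>pi\<close> is discarded
  at the end.\<close>

lemma abs_cot_le_cmod:
  fixes m :: int and p :: nat
  assumes "p > 0" "\<not> int p dvd m"
  shows "\<bar>cot (pi * real_of_int m / real p)\<bar> \<le> real p / real_of_int \<bar>m cmod int p\<bar>"
proof -
  define r where "r = m cmod int p"
  have m: "m = m cdiv int p * int p + r" by (simp add: r_def cdiv_mult_cmod_eq)
  hence r0: "r \<noteq> 0" using assms(2) by (metis add.right_neutral dvd_triv_right)
  have "pi * real_of_int m / real p = pi * real_of_int r / real p + real_of_int (m cdiv int p) * pi"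
    using assms(1) by (subst m) (simp add: field_simps)
  hence "cot (pi * real_of_int m / real p) = cot (pi * real_of_int r / real p)"
    by (simp add: cot_altdef)
  also have "\<bar>\<dots>\<bar> = \<bar>cot (pi * real_of_int \<bar>r\<bar> / real p)\<bar>"
    by (cases "r \<ge> 0") auto
  also have "\<dots> \<le> 1 / (pi * real_of_int \<bar>r\<bar> / real p)"
  proof (rule abs_cot_le)
    have "\<bar>r\<bar> \<le> int p div 2"
      using abs_cmod_less_equal[of "int p" m] assms(1) by (simp add: r_def)
    hence "2 * real_of_int \<bar>r\<bar> \<le> real p" by linarith
    thus "pi * real_of_int \<bar>r\<bar> / real p \<le> pi / 2" using assms(1) by (simp add: field_simps)
  qed (use r0 assms(1) in auto)
  also have "\<dots> = real p / (pi * real_of_int \<bar>r\<bar>)" by simp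
  also have "\<dots> \<le> real p / real_of_int \<bar>r\<bar>"
    using r0 pi_gt3 by (intro divide_left_mono) (auto simp: mult_le_cancel_right1)
  finally show ?thesis by (simp add: r_def)
qed

text \<open>The difference \<open>harm n - ln n\<close> decreases from its value 1 at
  \<open>n = 1\<close>.\<close>

lemma harm_le_one_plus_ln:
  assumes "n > 0"
  shows "harm n \<le> 1 + ln (real n)"
proof -
  obtain m where "n = Suc m" using assms by (cases n) auto
  thus ?thesis using decseqD[OF decseq_harm_diff_ln, of 0 m] by (simp add: harm_Suc harm_expand(1))
qed

text \<open>Multiplication by \<open>c\<close> permutes the nonzero residues, which reduces the
  claim to \<open>c = 1\<close>. There the absolute least residue of \<open>j\<close> is
  \<open>j\<close> or \<open>p - j\<close>, and bounding by both reciprocals gives two harmonic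
  sums.\<close>

lemma sum_inverse_abs_cmod_le:
  assumes "prime p" "\<not> int p dvd c"
  shows "(\<Sum>n = 1..p - 1. 1 / real_of_int \<bar>int n * c cmod int p\<bar>) \<le> 2 * (1 + ln (real p))"
proof -
  define g where "g = (\<lambda>j. 1 / real_of_int \<bar>int j cmod int p\<bar>)"
  define \<sigma> where "\<sigma> = (\<lambda>n. nat (int n * c mod int p))"
  have p: "p > 1" using assms(1) by (rule prime_gt_1_nat)
  have \<sigma>: "int (\<sigma> n) = int n * c mod int p" for n using p by (simp add: \<sigma>_def)
  have inj: "inj_on \<sigma> {1..p-1}"
  proof (rule inj_onI)
    fix m n assume mn: "m \<in> {1..p-1}" "n \<in> {1..p-1}" "\<sigma> m = \<sigma> n"
    hence "[int m * c = int n * c] (mod int p)" unfolding cong_def by (metis \<sigma>)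
    moreover have "coprime c (int p)"
      using assms prime_imp_coprime[of "int p" c] by (simp add: coprime_commute)
    ultimately have "[int m = int n] (mod int p)" by (simp add: cong_mult_rcancel)
    hence "[m = n] (mod p)" by (simp add: cong_int_iff)
    thus "m = n" using mn p by (intro cong_less_modulus_unique_nat[of m n p]) auto
  qed
  have "\<sigma> n \<in> {1..p-1}" if "n \<in> {1..p-1}" for n
  proof -
    have "\<not> int p dvd int n * c"
      using assms that p by (auto simp: prime_dvd_mult_iff dest!: dvd_imp_le)
    hence "int (\<sigma> n) \<noteq> 0" by (simp add: \<sigma> dvd_eq_mod_eq_0)
    moreover have "int (\<sigma> n) < int p" using p by (simp add: \<sigma>)
    ultimately show ?thesis by auto
  qed
  hence "bij_betw \<sigma> {1..p-1} {1..p-1}"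
    using inj by (intro bij_betw_imageI endo_inj_surj) blast+
  hence "(\<Sum>n = 1..p - 1. g (\<sigma> n)) = (\<Sum>j = 1..p - 1. g j)"
    by (rule sum.reindex_bij_betw)
  moreover have "g (\<sigma> n) = 1 / real_of_int \<bar>int n * c cmod int p\<bar>" for n
    unfolding g_def \<sigma> centered_modulo_def by (simp add: mod_add_left_eq)
  moreover have "g j \<le> 1 / real j + 1 / real (p - j)" if "j \<in> {1..p-1}" for j
  proof -
    have j: "0 < j" "j < p" using that p by auto
    have "int j cmod int p = int j \<or> int j cmod int p = int j - int p"
    proof (cases "int j + int p div 2 < int p")
      case True
      thus ?thesis by (simp add: centered_modulo_def)
    next
      case False
      hence "(int j + int p div 2) mod int p = int j + int p div 2 - int p"
        using j mod_pos_pos_trivial[of "int j + int p div 2 - int p" "int p"] by simp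
      thus ?thesis by (simp add: centered_modulo_def)
    qed
    thus ?thesis using j by (auto simp: g_def of_nat_diff)
  qed
  hence "(\<Sum>j = 1..p - 1. g j) \<le> (\<Sum>j = 1..p - 1. 1 / real j + 1 / real (p - j))"
    by (rule sum_mono)
  moreover have "(\<Sum>j = 1..p - 1. 1 / real (p - j)) = (\<Sum>j = 1..p - 1. 1 / real j)"
    by (rule sum.reindex_bij_witness[of _ "\<lambda>j. p - j" "\<lambda>j. p - j"]) (use p in auto)
  moreover have "(\<Sum>j = 1..p - 1. 1 / real j) \<le> 1 + ln (real p)"
  proof -
    have "(\<Sum>j = 1..p - 1. 1 / real j) = harm (p - 1)" by (simp add: harm_def inverse_eq_divide)
    also have "\<dots> \<le> harm p" by (rule harm_mono) simp
    also have "\<dots> \<le> 1 + ln (real p)" using p by (intro harm_le_one_plus_ln) simp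
    finally show ?thesis .
  qed
  ultimately show ?thesis by (simp add: sum.distrib)
qed

section \<open>Assembly of the estimate for the Dedekind sum\<close>

theorem theorem3p3:
  fixes q1 q2 k :: nat
  assumes "k \<ge> 3"
  shows "\<exists>C::real. \<forall>(p::nat) (h::int).
           prime p \<longrightarrow> \<not> p dvd q1 * q2 \<longrightarrow> coprime h (int p) \<longrightarrow> ord (int p) h = k \<longrightarrow>
             \<bar>dedekind_rademacher_sum (int q1) (int q2 * h) p\<bar>
               \<le> C * (ln (real p))\<^sup>2 * real p powr (1 - 1 / real (totient k))"
proof -
  define f where "f = totient k"
  have f: "f > 0" using assms by (simp add: f_def)
  obtain A :: int where A: "A \<ge> 1" and A_bound:
    "\<And>p h X Y N. \<lbrakk>prime p; coprime h (int p); ord (int p) h = k; Y \<noteq> 0;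
        [X = h * Y] (mod int p); \<bar>X\<bar> \<le> N; \<bar>Y\<bar> \<le> N\<rbrakk> \<Longrightarrow> int p \<le> A * N ^ f"
    using prime_le_norm_form[OF assms] unfolding f_def by metis
  \<comment> \<open>The factor \<open>max q1 q2\<close> pays for applying \<open>A_bound\<close> to
    \<open>q1 * Y\<close> and \<open>q2 * X\<close> instead of \<open>Y\<close> and
    \<open>X\<close>.\<close>
  define K where "K = A * int (max q1 q2)"
  show ?thesis
  proof (rule exI[of _ "2 * real_of_int K"], intro allI impI)
    fix p :: nat and h :: int
    assume p: "prime p" and q: "\<not> p dvd q1 * q2" and h: "coprime h (int p)" "ord (int p) h = k"
    define b where "b = int q1"
    define c where "c = int q2 * h"
    define M where "M = real p powr (1 / real f)"
    have p1: "p > 1" using p by (rule prime_gt_1_nat)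
    have M: "M > 0" using p1 by (simp add: M_def)
    have K: "K \<ge> 0" using A by (simp add: K_def)
    have ndvd: "\<not> p dvd q1" "\<not> p dvd q2" using q by auto
    have "\<not> int p dvd h"
      using coprime_common_divisor[OF h(1) _ dvd_refl] p1 by auto
    hence bc: "\<not> int p dvd b" "\<not> int p dvd c"
      using p ndvd by (auto simp: b_def c_def prime_dvd_mult_iff)
    \<comment> \<open>Modulo 2 an odd \<open>h\<close> has order 1. Excluding \<open>p = 2\<close>
      gives \<open>ln p \<ge> 1\<close> below, as \<open>exp 1 \<le> 3\<close>.\<close>
    have p3: "p \<ge> 3"
    proof (rule ccontr)
      assume "\<not> p \<ge> 3"
      hence "p = 2" using p1 by simp
      hence "[h ^ 1 = 1] (mod int p)" using h(1) by (simp add: cong_def odd_iff_mod_2_eq_one)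
      thus False using ord_int_prime(3)[OF p h(1), of 1] h(2) assms by simp
    qed
    define x where "x = (\<lambda>n. real_of_int \<bar>int n * b cmod int p\<bar>)"
    define y where "y = (\<lambda>n. real_of_int \<bar>int n * c cmod int p\<bar>)"
    have term_bound:
      "\<bar>cot (pi * real n * real_of_int b / real p) * cot (pi * real n * real_of_int c / real p)\<bar>
         \<le> (real p)\<^sup>2 * (K / M) * (1 / x n + 1 / y n)" if n: "n \<in> {1..p-1}" for n
    proof -
      define X where "X = int n * b cmod int p"
      define Y where "Y = int n * c cmod int p"
      define m where "m = max \<bar>X\<bar> \<bar>Y\<bar>"
      have "\<not> int p dvd int n" using n p1 by (auto dest!: dvd_imp_le)
      hence nd: "\<not> int p dvd int n * b" "\<not> int p dvd int n * c"
        using bc p by (auto simp: prime_dvd_mult_iff)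
      have cong: "[X = int n * b] (mod int p)" "[Y = int n * c] (mod int p)"
        unfolding X_def Y_def by (metis cong_iff_lin cmod_mult_cdiv_eq)+
      have XY: "X \<noteq> 0" "Y \<noteq> 0" using cong[THEN cong_sym] nd by (auto simp: cong_0_iff)
      have "[int q1 * Y = int q1 * (int n * c)] (mod int p)"
        by (intro cong_mult cong) auto
      also have "int q1 * (int n * c) = h * (int q2 * (int n * b))"
        by (simp add: b_def c_def mult_ac)
      also have "[h * (int q2 * (int n * b)) = h * (int q2 * X)] (mod int p)"
        by (intro cong_mult cong_sym[OF cong(1)]) auto
      finally have "[int q1 * Y = h * (int q2 * X)] (mod int p)" .
      moreover have "int q2 * X \<noteq> 0" using XY(1) ndvd(2) by (cases q2) auto
      moreover have "\<bar>int q1 * Y\<bar> \<le> int (max q1 q2) * m" "\<bar>int q2 * X\<bar> \<le> int (max q1 q2) * m"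
        by (auto simp: abs_mult m_def intro!: mult_mono)
      ultimately have "int p \<le> A * (int (max q1 q2) * m) ^ f"
        using A_bound[OF p h] by blast
      \<comment> \<open>Turns the right-hand side into a perfect \<open>f\<close>-th power, so that
        the root yields \<open>M \<le> K * m\<close>.\<close>
      also have "\<dots> \<le> A ^ f * (int (max q1 q2) * m) ^ f"
        using A f self_le_power[of A f] by (intro mult_right_mono) (auto simp: m_def)
      also have "\<dots> = (K * m) ^ f" by (simp add: K_def power_mult_distrib mult_ac)
      finally have "real p \<le> real_of_int (K * m) ^ f"
        by (metis of_int_le_iff of_int_of_nat_eq of_int_power)
      hence "M \<le> (real_of_int (K * m) ^ f) powr (1 / real f)"
        unfolding M_def by (intro powr_mono2) auto
      also have "\<dots> = real_of_int K * real_of_int m"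
        using f K powr_realpow'
        by (simp add: m_def root_powr_inverse[symmetric] real_root_power_cancel)
      finally have Mm: "M \<le> real_of_int K * real_of_int m" .
      have pos: "x n > 0" "y n > 0" using XY by (auto simp: x_def y_def X_def Y_def)
      have m: "real_of_int m = max (x n) (y n)" by (simp add: m_def x_def y_def X_def Y_def of_int_max)
      have "1 / (x n * y n) * M \<le> 1 / (x n * y n) * (K * max (x n) (y n))"
        using pos Mm m by (intro mult_left_mono) auto
      \<comment> \<open>The maximum divided by the product is the reciprocal of the minimum, hence
        at most the sum of both reciprocals.\<close>
      also have "\<dots> \<le> K * (1 / x n + 1 / y n)"
        using pos K by (auto simp: max_def field_simps mult_left_mono)
      finally have key: "1 / (x n * y n) \<le> K / M * (1 / x n + 1 / y n)"
        using M by (simp add: field_simps)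
      have "\<bar>cot (pi * real n * real_of_int b / real p) * cot (pi * real n * real_of_int c / real p)\<bar>
              \<le> (real p / x n) * (real p / y n)"
        unfolding abs_mult x_def y_def
        using abs_cot_le_cmod[OF _ nd(1)] abs_cot_le_cmod[OF _ nd(2)] p1
        by (intro mult_mono) (auto simp: mult_ac)
      also have "\<dots> = (real p)\<^sup>2 * (1 / (x n * y n))" by (simp add: power2_eq_square)
      also have "\<dots> \<le> (real p)\<^sup>2 * (K / M * (1 / x n + 1 / y n))"
        using key by (intro mult_left_mono) auto
      finally show ?thesis by (simp only: mult.assoc)
    qed
    have "ln (real p) \<ge> 1"
      using p3 exp_le by (subst ln_ge_iff) auto
    \<comment> \<open>For \<open>L \<ge> 1\<close> both 1 and \<open>L\<close> are at most
      \<open>L\<close> squared; this is the source of the 2 in the final constant.\<close>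
    hence ln: "1 + ln (real p) \<le> 2 * (ln (real p))\<^sup>2"
      using mult_mono[of 1 "ln (real p)" 1 "ln (real p)"] self_le_power[of "ln (real p)" 2] by auto
    have "\<bar>dedekind_rademacher_sum b c p\<bar> \<le>
            1 / (4 * real p) * (\<Sum>n = 1..p - 1. (real p)\<^sup>2 * (K / M) * (1 / x n + 1 / y n))"
      unfolding dedekind_rademacher_sum_def abs_mult
      by (intro mult_mono order_trans[OF sum_abs] sum_mono term_bound) auto
    also have "\<dots> = real p * (K / M) / 4 * ((\<Sum>n = 1..p - 1. 1 / x n) + (\<Sum>n = 1..p - 1. 1 / y n))"
      unfolding sum.distrib sum_distrib_left[symmetric] using p1 by (simp add: power2_eq_square)
    \<comment> \<open>The two harmonic bounds add up to \<open>4 * (1 + ln p)\<close>, which cancels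
      the 4 in the normalization of the sum.\<close>
    also have "\<dots> \<le> real p * (K / M) / 4 * (2 * (1 + ln (real p)) + 2 * (1 + ln (real p)))"
      unfolding x_def y_def using K M
      by (intro mult_left_mono add_mono sum_inverse_abs_cmod_le p bc) auto
    also have "\<dots> = real p * (K / M) * (1 + ln (real p))" using M by (simp add: field_simps)
    also have "\<dots> \<le> real p * (K / M) * (2 * (ln (real p))\<^sup>2)"
      using K M ln by (intro mult_left_mono) auto
    also have "\<dots> = 2 * K * (ln (real p))\<^sup>2 * real p powr (1 - 1 / real f)"
      using p1 by (simp add: M_def powr_diff)
    finally show "\<bar>dedekind_rademacher_sum (int q1) (int q2 * h) p\<bar>
        \<le> 2 * real_of_int K * (ln (real p))\<^sup>2 * real p powr (1 - 1 / real (totient k))"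
      by (simp add: b_def c_def f_def)
  qed
qed

end
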